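(* Consider the continuation-ratio logit model with nonproportional odds: $\log\left(\frac{\pi_{ij}}{\pi_{i,j+1}+\cdots+\pi_{iJ}}\right)=\mathbf h_j^T(\mathbf x_i)\boldsymbol\beta_j$ for $i=1,\dots,m$, $j=1,\dots,J-1$. Let $\sigma_1,\sigma_2$ be permutations of $\{1,\dots,J\}$. If $\sigma_2=\sigma_1\,(J-1,J)$, where $(J-1,J)$ is the transposition that switches $J-1$ and $J$ and the product is composition $(\sigma\sigma')(j)=\sigma(\sigma'(j))$, then $\sigma_1\sim\sigma_2$.
   Context: Setting. Let $d\ge1$, $m\ge1$, $J\ge3$. The data are $\{(\mathbf x_i,\mathbf Y_i): i=1,\dots,m\}$, where $\mathbf x_1,\dots,\mathbf x_m\in\mathbb R^d$ are distinct covariate settings and $\mathbf Y_i=(Y_{i1},\dots,Y_{iJ})^T$ is a vector of nonnegative integer counts with $n_i=\sum_{j=1}^JY_{ij}>0$. The model assumes $\mathbf Y_i\sim\mathrm{Multinomial}(n_i;\pi_{i1},\dots,\pi_{iJ})$ independently over $i$, with $\pi_{ij}>0$ and $\sum_{j=1}^J\pi_{ij}=1$. Model. $\mathbf h_j:\mathbb R^d\to\mathbb R^{p_j}$ ($j=1,\dots,J-1$) are known predictor functions, and the unknown parameter is $\boldsymbol\theta=(\boldsymbol\beta_1^T,\dots,\boldsymbol\beta_{J-1}^T)^T$ with $\boldsymbol\beta_j\in\mathbb R^{p_j}$, ranging over $\boldsymbol\Theta=\mathbb R^p$, $p=p_1+\cdots+p_{J-1}$. For $\boldsymbol\theta\in\boldsymbol\Theta$,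 $(\pi_{i1}(\boldsymbol\theta),\dots,\pi_{iJ}(\boldsymbol\theta))$ denotes the unique positive probability vector satisfying the model equations at $\mathbf x_i$. Orders and equivalence. An order is a permutation $\sigma$ of $\{1,\dots,J\}$. Fitting the model with order $\sigma$ means fitting it to the permuted data $\mathbf Y_i^\sigma=(Y_{i\sigma(1)},\dots,Y_{i\sigma(J)})^T$, so the likelihood function with order $\sigma$ is $$L_\sigma(\boldsymbol\theta)=\prod_{i=1}^m\frac{n_i!}{\prod_{j=1}^JY_{i\sigma(j)}!}\prod_{j=1}^J\pi_{ij}(\boldsymbol\theta)^{Y_{i\sigma(j)}} .$$ Two orders are equivalent, $\sigma_1\sim\sigma_2$, if $\sup_{\boldsymbol\theta\in\boldsymbol\Theta}L_{\sigma_1}(\boldsymbol\theta)=\sup_{\boldsymbol\theta\in\boldsymbol\Theta}L_{\sigma_2}(\boldsymbol\theta)$. *)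

theory Defs
  imports Complex_Main "HOL-Library.FuncSet" "HOL-Combinatorics.Permutations"
    "Jordan_Normal_Form.Matrix"
begin

text \<open>
  Categories, predictors and observations are numbered from 1, while the entries of a vector of
  type \<^typ>\<open>real vec\<close> are numbered from 0.
\<close>

text \<open>
  The parameter is the concatenation of the blocks \<open>\<beta>\<^sub>1, \<dots>, \<beta>\<^bsub>J-1\<^esub>\<close> of
  dimensions \<open>p 1, \<dots>, p (J - 1)\<close>.
\<close>

definition param_space :: "nat \<Rightarrow> (nat \<Rightarrow> nat) \<Rightarrow> real vec set" where
  "param_space J p = carrier_vec (\<Sum>j = 1..J - 1. p j)"

definition beta :: "(nat \<Rightarrow> nat) \<Rightarrow> real vec \<Rightarrow> nat \<Rightarrow> real vec" where
  "beta p \<theta> j = vec (p j) (\<lambda>k. \<theta> $ ((\<Sum>l = 1..<j. p l) + k))"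

text \<open>Extensionality makes a probability vector unique as a function on all of \<^typ>\<open>nat\<close>.\<close>

definition pos_prob_vec :: "nat \<Rightarrow> (nat \<Rightarrow> real) \<Rightarrow> bool" where
  "pos_prob_vec J q \<longleftrightarrow>
     q \<in> extensional {1..J} \<and> (\<forall>j\<in>{1..J}. q j > 0) \<and> (\<Sum>j = 1..J. q j) = 1"

text \<open>The continuation-ratio logit model with nonproportional odds at covariate setting \<open>z\<close>.\<close>

definition cratio_npo_eqs ::
  "nat \<Rightarrow> (nat \<Rightarrow> nat) \<Rightarrow> (nat \<Rightarrow> real vec \<Rightarrow> real vec) \<Rightarrow> real vec \<Rightarrow> real vec \<Rightarrow> (nat \<Rightarrow> real) \<Rightarrow> bool" where
  "cratio_npo_eqs J p h z \<theta> q \<longleftrightarrow>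
     (\<forall>j\<in>{1..J - 1}. ln (q j / (\<Sum>k = j + 1..J. q k)) = h j z \<bullet> beta p \<theta> j)"

definition cratio_npo_prob ::
  "nat \<Rightarrow> (nat \<Rightarrow> nat) \<Rightarrow> (nat \<Rightarrow> real vec \<Rightarrow> real vec) \<Rightarrow> real vec \<Rightarrow> real vec \<Rightarrow> nat \<Rightarrow> real" where
  "cratio_npo_prob J p h z \<theta> = (THE q. pos_prob_vec J q \<and> cratio_npo_eqs J p h z \<theta> q)"

text \<open>
  The next two definitions do not depend on the model: \<open>\<pi> z \<theta> j\<close> is the probability of
  category \<open>j\<close> at covariate setting \<open>z\<close>.
\<close>

definition likelihood ::
  "nat \<Rightarrow> nat \<Rightarrow> (nat \<Rightarrow> real vec) \<Rightarrow> (nat \<Rightarrow> nat \<Rightarrow> nat) \<Rightarrow> (real vec \<Rightarrow> real vec \<Rightarrow> nat \<Rightarrow> real) \<Rightarrow>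
   (nat \<Rightarrow> nat) \<Rightarrow> real vec \<Rightarrow> real" where
  "likelihood m J x Y \<pi> \<sigma> \<theta> =
     (\<Prod>i = 1..m. fact (\<Sum>j = 1..J. Y i j) / (\<Prod>j = 1..J. fact (Y i (\<sigma> j)))
        * (\<Prod>j = 1..J. \<pi> (x i) \<theta> j ^ Y i (\<sigma> j)))"

text \<open>
  The suprema are those of nonempty sets of reals; each factor of the likelihood is a multinomial
  probability, so the sets are bounded above by 1.
\<close>

definition equiv_orders ::
  "nat \<Rightarrow> nat \<Rightarrow> (nat \<Rightarrow> real vec) \<Rightarrow> (nat \<Rightarrow> nat \<Rightarrow> nat) \<Rightarrow> (real vec \<Rightarrow> real vec \<Rightarrow> nat \<Rightarrow> real) \<Rightarrow>
   real vec set \<Rightarrow> (nat \<Rightarrow> nat) \<Rightarrow> (nat \<Rightarrow> nat) \<Rightarrow> bool" where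
  "equiv_orders m J x Y \<pi> \<Theta> \<sigma>\<^sub>1 \<sigma>\<^sub>2 \<longleftrightarrow>
     (SUP \<theta>\<in>\<Theta>. likelihood m J x Y \<pi> \<sigma>\<^sub>1 \<theta>) = (SUP \<theta>\<in>\<Theta>. likelihood m J x Y \<pi> \<sigma>\<^sub>2 \<theta>)"

end

theory Submission
  imports Defs
begin

text \<open>
  Negating the last block \<open>\<beta>\<^bsub>J-1\<^esub>\<close> inverts the odds \<open>\<pi>\<^bsub>J-1\<^esub> / \<pi>\<^bsub>J\<^esub>\<close>
  and leaves \<open>\<pi>\<^bsub>J-1\<^esub> + \<pi>\<^bsub>J\<^esub>\<close> and all other probabilities alone, so it interchanges the last two
  probabilities. It is an involution of the parameter space that carries one likelihood
  function into the other; hence both have the same set of values.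
\<close>

text \<open>The product is the tail probability \<open>\<pi>\<^sub>j + \<dots> + \<pi>\<^bsub>J\<^esub>\<close>.\<close>

definition cratio_vec :: "nat \<Rightarrow> (nat \<Rightarrow> real) \<Rightarrow> nat \<Rightarrow> real" where
  "cratio_vec J \<eta> = restrict (\<lambda>j. (\<Prod>l = 1..<j. inverse (1 + exp (\<eta> l)))
     * (if j = J then 1 else exp (\<eta> j) / (1 + exp (\<eta> j)))) {1..J}"

text \<open>Downward induction from \<open>J\<close>, which takes all that is left: at each earlier
  split the shares \<open>exp (\<eta> n) / (1 + exp (\<eta> n))\<close> and
  \<open>inverse (1 + exp (\<eta> n))\<close> add up to 1. At \<open>j = 1\<close> the empty product
  gives total mass 1.\<close>

lemma sum_cratio_vec:
  assumes "1 \<le> j" "j \<le> J"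
  shows "(\<Sum>k = j..J. cratio_vec J \<eta> k) = (\<Prod>l = 1..<j. inverse (1 + exp (\<eta> l)))"
  using assms(2,1)
proof (induction j rule: inc_induct)
  case base
  then show ?case by (simp add: cratio_vec_def)
next
  case (step n)
  have pos: "1 + exp (\<eta> n) > 0" by (simp add: add_pos_pos)
  have "(\<Sum>k = n..J. cratio_vec J \<eta> k) = cratio_vec J \<eta> n + (\<Sum>k = Suc n..J. cratio_vec J \<eta> k)"
    using step.hyps by (simp add: sum.atLeast_Suc_atMost)
  also have "\<dots> = (\<Prod>l = 1..<n. inverse (1 + exp (\<eta> l)))
      * (exp (\<eta> n) / (1 + exp (\<eta> n)) + inverse (1 + exp (\<eta> n)))"
    using step by (simp add: cratio_vec_def prod.atLeastLessThan_Suc algebra_simps)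
  also have "exp (\<eta> n) / (1 + exp (\<eta> n)) + inverse (1 + exp (\<eta> n)) = 1"
    using pos by (simp add: field_simps)
  finally show ?case by simp
qed

lemma pos_prob_vec_cratio_vec:
  assumes "1 \<le> J"
  shows "pos_prob_vec J (cratio_vec J \<eta>)"
proof -
  have "cratio_vec J \<eta> j > 0" if "j \<in> {1..J}" for j
    using that by (auto simp: cratio_vec_def add_pos_pos intro!: mult_pos_pos divide_pos_pos prod_pos)
  moreover have "cratio_vec J \<eta> \<in> extensional {1..J}"
    by (simp add: cratio_vec_def)
  ultimately show ?thesis
    using sum_cratio_vec[of 1 J \<eta>] assms by (simp add: pos_prob_vec_def)
qed

text \<open>Existence half for the model equations: the tail at \<open>j\<close> is divided between
  \<open>j\<close> and the later categories in the ratio \<open>exp (\<eta> j)\<close> to 1.\<close>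

lemma ln_cratio_vec:
  assumes "j \<in> {1..J - 1}"
  shows "ln (cratio_vec J \<eta> j / (\<Sum>k = j + 1..J. cratio_vec J \<eta> k)) = \<eta> j"
proof -
  define P where "P = (\<Prod>l = 1..<j. inverse (1 + exp (\<eta> l)))"
  have "P > 0" unfolding P_def by (auto intro!: prod_pos simp: add_pos_pos)
  moreover have "1 + exp (\<eta> j) > 0" by (simp add: add_pos_pos)
  moreover have "(\<Sum>k = j + 1..J. cratio_vec J \<eta> k) = P / (1 + exp (\<eta> j))"
    using assms sum_cratio_vec[of "j + 1" J \<eta>]
    by (auto simp: P_def prod.atLeastLessThan_Suc divide_inverse)
  moreover have "cratio_vec J \<eta> j = P * exp (\<eta> j) / (1 + exp (\<eta> j))"
    using assms by (auto simp: cratio_vec_def P_def)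
  ultimately have "cratio_vec J \<eta> j / (\<Sum>k = j + 1..J. cratio_vec J \<eta> k) = exp (\<eta> j)"
    by simp
  then show ?thesis by simp
qed

text \<open>The equations become a recursion: each tail sum is \<open>1 + exp (\<eta> j)\<close>
  times the next one. Starting from total mass 1, it determines all tails and hence
  \<open>q\<close>.\<close>

lemma cratio_vec_unique:
  assumes q: "pos_prob_vec J q"
    and eqs: "\<And>j. j \<in> {1..J - 1} \<Longrightarrow> ln (q j / (\<Sum>k = j + 1..J. q k)) = \<eta> j"
  shows "q = cratio_vec J \<eta>"
proof (rule extensionalityI[of _ "{1..J}"])
  show "q \<in> extensional {1..J}" using q by (simp add: pos_prob_vec_def)
  show "cratio_vec J \<eta> \<in> extensional {1..J}" by (simp add: cratio_vec_def)
  have qj: "q j = exp (\<eta> j) * (\<Sum>k = j + 1..J. q k)" if "j \<in> {1..J - 1}" for j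
  proof -
    \<comment> \<open>\<open>ln\<close> is total, so undoing it takes a positive quotient; the sum
      is nonempty because \<open>j \<le> J - 1\<close>.\<close>
    have "(\<Sum>k = j + 1..J. q k) > 0"
      using q that by (intro sum_pos) (auto simp: pos_prob_vec_def)
    moreover have "q j > 0" using q that by (auto simp: pos_prob_vec_def)
    ultimately show ?thesis
      using eqs[OF that] by (metis divide_pos_pos exp_ln nonzero_eq_divide_eq less_irrefl)
  qed
  have tail: "(\<Sum>k = j..J. q k) = (\<Prod>l = 1..<j. inverse (1 + exp (\<eta> l)))"
    if "1 \<le> j" "j \<le> J" for j
    using that
  proof (induction j rule: dec_induct)
    case base
    show ?case using q by (simp add: pos_prob_vec_def)
  next
    case (step n)
    have pos: "1 + exp (\<eta> n) > 0" by (simp add: add_pos_pos)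
    have "(\<Sum>k = n..J. q k) = q n + (\<Sum>k = Suc n..J. q k)"
      using step by (simp add: sum.atLeast_Suc_atMost)
    also have "\<dots> = (1 + exp (\<eta> n)) * (\<Sum>k = Suc n..J. q k)"
      using qj[of n] step by (simp add: algebra_simps)
    finally show ?case
      using pos step by (simp add: prod.atLeastLessThan_Suc field_simps)
  qed
  fix j assume j: "j \<in> {1..J}"
  show "q j = cratio_vec J \<eta> j"
  proof (cases "j = J")
    case True
    then show ?thesis using tail[of J] j by (simp add: cratio_vec_def)
  next
    case False
    then have "j \<in> {1..J - 1}" "j + 1 \<le> J" using j by auto
    then show ?thesis
      using qj[of j] tail[of "j + 1"] False j
      by (simp add: cratio_vec_def prod.atLeastLessThan_Suc field_simps)
  qed
qed

text \<open>Existence and uniqueness together evaluate the \<open>THE\<close>; the parameter enters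
  only through the linear predictors.\<close>

lemma cratio_npo_prob_eq_cratio_vec:
  assumes "1 \<le> J"
  shows "cratio_npo_prob J p h z \<theta> = cratio_vec J (\<lambda>j. h j z \<bullet> beta p \<theta> j)"
  unfolding cratio_npo_prob_def cratio_npo_eqs_def
  using assms by (intro the_equality)
    (auto simp: pos_prob_vec_cratio_vec ln_cratio_vec[simplified] intro: cratio_vec_unique)

text \<open>The last split gives \<open>J - 1\<close> and \<open>J\<close> the values of the
  logistic function at \<open>t = \<eta> (J - 1)\<close> and at \<open>- t\<close> as shares of the
  remaining mass, so a change of sign exchanges them.\<close>

lemma cratio_vec_transpose:
  assumes "2 \<le> J" "j \<in> {1..J}" "\<eta>' (J - 1) = - \<eta> (J - 1)"
    and "\<And>j. j \<in> {1..<J - 1} \<Longrightarrow> \<eta>' j = \<eta> j"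
  shows "cratio_vec J \<eta> (transpose (J - 1) J j) = cratio_vec J \<eta>' j"
proof -
  obtain K where K: "J = Suc K" "1 \<le> K" using assms(1) by (cases J) auto
  have flip: "exp (- t) / (1 + exp (- t)) = inverse (1 + exp t)"
    "exp t / (1 + exp t) = inverse (1 + exp (- t))" for t :: real
    by (simp_all add: exp_minus add_pos_pos field_simps add_nonneg_eq_0_iff)
  \<comment> \<open>With \<open>j \<le> K\<close> only indices below \<open>J - 1\<close> occur,
    where the predictors agree. For \<open>j = J\<close> the factor at \<open>K\<close> is split off
    and treated by \<open>flip\<close>.\<close>
  have prod: "(\<Prod>l = 1..<j. inverse (1 + exp (\<eta>' l))) = (\<Prod>l = 1..<j. inverse (1 + exp (\<eta> l)))"
    if "j \<le> K" for j
    using assms(4) that K by (intro prod.cong) auto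
  consider "j = J" | "j = K" | "1 \<le> j" "j < K" using assms(2) K by force
  then show ?thesis
    using assms K
    by cases (simp_all add: cratio_vec_def prod prod.atLeastLessThan_Suc flip transpose_eq_iff)
qed

text \<open>The cut-off is the 0-based offset at which \<open>beta\<close> reads block
  \<open>J - 1\<close>; all entries from there on belong to that block.\<close>

definition negate_last :: "nat \<Rightarrow> (nat \<Rightarrow> nat) \<Rightarrow> real vec \<Rightarrow> real vec" where
  "negate_last J p \<theta> = vec (\<Sum>j = 1..J - 1. p j)
     (\<lambda>k. if k < (\<Sum>l = 1..<J - 1. p l) then \<theta> $ k else - \<theta> $ k)"

lemma negate_last_in_param_space: "negate_last J p \<theta> \<in> param_space J p"
  by (simp add: negate_last_def param_space_def)

lemma negate_last_negate_last:
  "\<theta> \<in> param_space J p \<Longrightarrow> negate_last J p (negate_last J p \<theta>) = \<theta>"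
  by (auto simp: negate_last_def param_space_def)

text \<open>Block \<open>j\<close> ends where block \<open>Suc j\<close> starts, and the offsets are
  monotone.\<close>

lemma block_index_less:
  fixes p :: "nat \<Rightarrow> nat"
  assumes "1 \<le> j" "j < n" "k < p j"
  shows "(\<Sum>l = 1..<j. p l) + k < (\<Sum>l = 1..<n. p l)"
proof -
  have "(\<Sum>l = 1..<j. p l) + k < (\<Sum>l = 1..<Suc j. p l)"
    using assms by simp
  also have "\<dots> \<le> (\<Sum>l = 1..<n. p l)"
    using assms by (intro sum_mono2) auto
  finally show ?thesis .
qed

lemma beta_negate_last:
  assumes "j \<in> {1..J - 1}"
  shows "beta p (negate_last J p \<theta>) j = (if j = J - 1 then - beta p \<theta> j else beta p \<theta> j)"
proof (rule eq_vecI)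
  fix k assume "k < dim_vec (if j = J - 1 then - beta p \<theta> j else beta p \<theta> j)"
  then have k: "k < p j" by (simp add: beta_def split: if_splits)
  \<comment> \<open>Taking \<open>n = J\<close> shows that the index lies inside the whole parameter
    vector.\<close>
  have "(\<Sum>l = 1..<j. p l) + k < (\<Sum>l = 1..<J. p l)"
    using assms k by (intro block_index_less) auto
  moreover have "{1..<J} = {1..J - 1}" using assms by auto
  ultimately have "(\<Sum>l = 1..<j. p l) + k < (\<Sum>l = 1..J - 1. p l)" by metis
  \<comment> \<open>Earlier blocks lie wholly before the cut-off, so their signs are kept.\<close>
  moreover have "(\<Sum>l = 1..<j. p l) + k < (\<Sum>l = 1..<J - 1. p l)" if "j \<noteq> J - 1"
    using assms k that by (intro block_index_less) auto
  ultimately show "beta p (negate_last J p \<theta>) j $ k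
      = (if j = J - 1 then - beta p \<theta> j else beta p \<theta> j) $ k"
    using k by (auto simp: beta_def negate_last_def)
qed (simp add: beta_def)

lemma cratio_npo_prob_negate_last:
  assumes "2 \<le> J" "j \<in> {1..J}" "h (J - 1) z \<in> carrier_vec (p (J - 1))"
  shows "cratio_npo_prob J p h z \<theta> (transpose (J - 1) J j)
    = cratio_npo_prob J p h z (negate_last J p \<theta>) j"
proof -
  \<comment> \<open>Matching dimensions let the minus sign be pulled out of the scalar
    product.\<close>
  have "beta p \<theta> (J - 1) \<in> carrier_vec (p (J - 1))" by (simp add: beta_def)
  then have "cratio_vec J (\<lambda>j. h j z \<bullet> beta p \<theta> j) (transpose (J - 1) J j)
      = cratio_vec J (\<lambda>j. h j z \<bullet> beta p (negate_last J p \<theta>) j) j"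
    using assms by (intro cratio_vec_transpose) (auto simp: beta_negate_last)
  then show ?thesis
    using assms(1) by (simp add: cratio_npo_prob_eq_cratio_vec)
qed

text \<open>Reindexing by \<open>\<tau>\<close> leaves the product of factorials unchanged and, as
  \<open>\<tau>\<close> is its own inverse, moves \<open>\<tau>\<close> from the exponents to the
  probabilities.\<close>

lemma likelihood_comp_involution:
  assumes "\<tau> permutes {1..J}" and "\<tau> \<circ> \<tau> = id"
    and "\<And>i j. i \<in> {1..m} \<Longrightarrow> j \<in> {1..J} \<Longrightarrow> \<pi> (x i) \<theta> (\<tau> j) = \<pi> (x i) \<theta>' j"
  shows "likelihood m J x Y \<pi> (\<sigma> \<circ> \<tau>) \<theta> = likelihood m J x Y \<pi> \<sigma> \<theta>'"
proof -
  have "(\<Prod>j = 1..J. fact (Y i ((\<sigma> \<circ> \<tau>) j))) = (\<Prod>j = 1..J. fact (Y i (\<sigma> j)) :: real)" for i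
    using prod.permute[OF assms(1), of "\<lambda>j. fact (Y i (\<sigma> j)) :: real"] by (simp add: comp_def)
  moreover have "(\<Prod>j = 1..J. \<pi> (x i) \<theta> j ^ Y i ((\<sigma> \<circ> \<tau>) j))
      = (\<Prod>j = 1..J. \<pi> (x i) \<theta>' j ^ Y i (\<sigma> j))" if "i \<in> {1..m}" for i
  proof -
    have "(\<Prod>j = 1..J. \<pi> (x i) \<theta> j ^ Y i ((\<sigma> \<circ> \<tau>) j))
        = (\<Prod>j = 1..J. \<pi> (x i) \<theta> (\<tau> j) ^ Y i (\<sigma> j))"
      using prod.permute[OF assms(1), of "\<lambda>j. \<pi> (x i) \<theta> j ^ Y i ((\<sigma> \<circ> \<tau>) j)"]
        fun_cong[OF assms(2)] by (simp add: comp_def)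
    also have "\<dots> = (\<Prod>j = 1..J. \<pi> (x i) \<theta>' j ^ Y i (\<sigma> j))"
      using assms(3) that by (intro prod.cong) auto
    finally show ?thesis .
  qed
  ultimately show ?thesis
    unfolding likelihood_def by (intro prod.cong) simp_all
qed

theorem theorem2p7:
  fixes d m J :: nat
    and x :: "nat \<Rightarrow> real vec"
    and Y :: "nat \<Rightarrow> nat \<Rightarrow> nat"
    and p :: "nat \<Rightarrow> nat"
    and h :: "nat \<Rightarrow> real vec \<Rightarrow> real vec"
    and \<sigma>\<^sub>1 \<sigma>\<^sub>2 :: "nat \<Rightarrow> nat"
  assumes "d \<ge> 1" and "m \<ge> 1" and "J \<ge> 3"
    and "x \<in> {1..m} \<rightarrow> carrier_vec d" and "inj_on x {1..m}"
    and "\<And>i. i \<in> {1..m} \<Longrightarrow> (\<Sum>j = 1..J. Y i j) > 0"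
    and "\<And>j. j \<in> {1..J - 1} \<Longrightarrow> h j \<in> carrier_vec d \<rightarrow> carrier_vec (p j)"
    and "\<sigma>\<^sub>1 permutes {1..J}" and "\<sigma>\<^sub>2 permutes {1..J}"
    and "\<sigma>\<^sub>2 = \<sigma>\<^sub>1 \<circ> transpose (J - 1) J"
  shows "equiv_orders m J x Y (cratio_npo_prob J p h) (param_space J p) \<sigma>\<^sub>1 \<sigma>\<^sub>2"
proof -
  let ?L = "likelihood m J x Y (cratio_npo_prob J p h)" and ?\<Theta> = "param_space J p"
  have L: "?L \<sigma>\<^sub>2 \<theta> = ?L \<sigma>\<^sub>1 (negate_last J p \<theta>)" for \<theta>
    unfolding assms(10)
  proof (rule likelihood_comp_involution)
    show "transpose (J - 1) J permutes {1..J}"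
      using assms(3) by (intro permutes_swap_id) auto
    fix i j assume "i \<in> {1..m}" "j \<in> {1..J}"
    moreover have "h (J - 1) (x i) \<in> carrier_vec (p (J - 1))"
      using assms(3,4) assms(7)[of "J - 1"] \<open>i \<in> {1..m}\<close> by (auto simp: Pi_iff)
    ultimately show "cratio_npo_prob J p h (x i) \<theta> (transpose (J - 1) J j)
        = cratio_npo_prob J p h (x i) (negate_last J p \<theta>) j"
      using assms(3) by (intro cratio_npo_prob_negate_last) auto
  qed simp
  \<comment> \<open>Surjectivity holds because the map is an involution.\<close>
  have "negate_last J p ` ?\<Theta> = ?\<Theta>"
    by (metis negate_last_in_param_space negate_last_negate_last image_eqI image_subsetI subsetI subset_antisym)
  \<comment> \<open>Equal sets of values have equal suprema, whether attained or not.\<close>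
  then have "?L \<sigma>\<^sub>2 ` ?\<Theta> = ?L \<sigma>\<^sub>1 ` ?\<Theta>"
    by (metis (no_types, lifting) L image_cong image_image)
  then show ?thesis
    by (simp add: equiv_orders_def)
qed

end
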